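(* For all sufficiently large odd integers $n$, $$t(n) \geq 0.0833\, n^2 .$$
   Context: For a positive integer $n$ let $[n]=\{1,\dots,n\}$. The $n\times n$ torus $\mathbb{T}_n$ is the hypergraph with vertex set $[n]\times[n]$ whose hyperedges are: the rows $\{i\}\times[n]$ for $i\in[n]$; the columns $[n]\times\{j\}$ for $j\in[n]$; the $\mathbb{Z}_n$-diagonals $\{(i,j)\in[n]\times[n] : i-j\equiv k \pmod n\}$ for $k\in\mathbb{Z}_n$; and the $\mathbb{Z}_n$-skew-diagonals $\{(i,j)\in[n]\times[n] : i+j\equiv k \pmod n\}$ for $k\in\mathbb{Z}_n$. A peaceful battle on $\mathbb{T}_n$ is a pair $(B,W)$ of disjoint subsets of $[n]\times[n]$ such that $e\cap B=\emptyset$ or $e\cap W=\emptyset$ for every hyperedge $e$ of $\mathbb{T}_n$. The number $t(n)$ is the maximum integer $m$ such that there is a peaceful battle $(B,W)$ on $\mathbb{T}_n$ with $|B|=|W|=m$. *)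

theory Defs
  imports Complex_Main "HOL-Number_Theory.Cong"
begin

definition torus_vertices :: "nat \<Rightarrow> (nat \<times> nat) set" where
  "torus_vertices n = {1..n} \<times> {1..n}"

definition torus_row :: "nat \<Rightarrow> nat \<Rightarrow> (nat \<times> nat) set" where
  "torus_row n i = {i} \<times> {1..n}"

definition torus_column :: "nat \<Rightarrow> nat \<Rightarrow> (nat \<times> nat) set" where
  "torus_column n j = {1..n} \<times> {j}"

text \<open>The index \<open>k\<close> of a (skew-)diagonal is an arbitrary integer standing for its residue
  class modulo \<open>n\<close>; congruent indices give the same set of vertices.\<close>

definition torus_diagonal :: "nat \<Rightarrow> int \<Rightarrow> (nat \<times> nat) set" where
  "torus_diagonal n k = {(i, j) \<in> torus_vertices n. [int i - int j = k] (mod int n)}"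

definition torus_skew_diagonal :: "nat \<Rightarrow> int \<Rightarrow> (nat \<times> nat) set" where
  "torus_skew_diagonal n k = {(i, j) \<in> torus_vertices n. [int i + int j = k] (mod int n)}"

definition torus_hyperedges :: "nat \<Rightarrow> (nat \<times> nat) set set" where
  "torus_hyperedges n =
     torus_row n ` {1..n} \<union> torus_column n ` {1..n} \<union>
     range (torus_diagonal n) \<union> range (torus_skew_diagonal n)"

definition peaceful_battle :: "nat \<Rightarrow> (nat \<times> nat) set \<Rightarrow> (nat \<times> nat) set \<Rightarrow> bool" where
  "peaceful_battle n B W \<longleftrightarrow>
     B \<subseteq> torus_vertices n \<and> W \<subseteq> torus_vertices n \<and> B \<inter> W = {} \<and>
     (\<forall>e \<in> torus_hyperedges n. e \<inter> B = {} \<or> e \<inter> W = {})"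

definition peaceful_sizes :: "nat \<Rightarrow> nat set" where
  "peaceful_sizes n = {m. \<exists>B W. peaceful_battle n B W \<and> card B = m \<and> card W = m}"

definition peaceful_number :: "nat \<Rightarrow> nat" where
  "peaceful_number n = Max (peaceful_sizes n)"

text \<open>The maximum is attained: it is taken over a finite nonempty set.\<close>

lemma finite_peaceful_sizes: "finite (peaceful_sizes n)"
proof (rule finite_subset)
  have "finite (torus_vertices n)"
    by (simp add: torus_vertices_def)
  then show "peaceful_sizes n \<subseteq> {..card (torus_vertices n)}"
    by (auto simp: peaceful_sizes_def peaceful_battle_def intro: card_mono)
qed simp

lemma peaceful_sizes_nonempty: "peaceful_sizes n \<noteq> {}"
proof -
  have "peaceful_battle n {} {}"
    by (simp add: peaceful_battle_def)
  then have "0 \<in> peaceful_sizes n"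
    unfolding peaceful_sizes_def by force
  then show ?thesis
    by blast
qed

end

theory Submission
  imports Defs
begin

text \<open>
  The theorem follows from an explicit peaceful battle with \<open>12 q\<^sup>2\<close> pieces on each side, where
  \<open>q = n div 12\<close>; since \<open>12 (n / 12)\<^sup>2 = n\<^sup>2 / 12\<close> and \<open>1 / 12 > 0.0833\<close>, the rounding error,
  which is linear in \<open>n\<close>, is absorbed as soon as \<open>n\<close> is large.

  The picture behind the battle lives on the torus of side \<open>12\<close> (in units of \<open>q\<close>). Black occupies
  the points of the square \<open>max \<bar>x\<bar> \<bar>y\<bar> \<le> 3\<close> around the origin with \<open>\<bar>x - y\<bar> \<le> 2\<close> and
  \<open>\<bar>x + y\<bar> \<ge> 2\<close>. White occupies the points of the antipodal square around \<open>(6, 6)\<close> whose local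
  coordinates satisfy the opposite inequalities \<open>\<bar>u - v\<bar> \<ge> 2\<close> and \<open>\<bar>u + v\<bar> \<le> 2\<close>, that is, a copy
  of the black region turned by a quarter. The two squares have no row or column in common, and
  their difference ranges meet only in the boundary value \<open>2\<close>. On a skew-diagonal
  the offset \<open>6 + 6 = 12\<close> of the centres vanishes modulo the side, so the sums are separated by
  the boundary value \<open>2\<close> too, and the largest black sums \<open>\<plusminus>6\<close> do not wrap around far enough to
  reach white.

  Each side consists of two pentagons, exchanged by the point reflection in its
  centre. The pentagon with vertices \<open>(2,0)\<close>, \<open>(3,1)\<close>, \<open>(3,3)\<close>, \<open>(1,3)\<close>, \<open>(0,2)\<close> is a square of
  area \<open>4\<close> with two triangles of area \<open>1\<close> attached, which gives the area \<open>12\<close> for each side.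
  For odd \<open>n = 2 h + 1\<close> the centre of the white square is the half-integral point
  \<open>(h + 1/2, h + 1/2)\<close>, so that its coordinate sum is exactly \<open>n\<close>.
\<close>

section \<open>A lattice pentagon\<close>

definition triangle :: "nat \<Rightarrow> (nat \<times> nat) set" where
  "triangle q = (SIGMA x : {1..q}. {2 * q - x <..< 2 * q + x})"

definition pentagon :: "nat \<Rightarrow> (nat \<times> nat) set" where
  "pentagon q = {q<..3 * q} \<times> {q<..3 * q} \<union> triangle q \<union> prod.swap ` triangle q"

lemma pentagonD:
  assumes "(x, y) \<in> pentagon q"
  shows "1 \<le> x \<and> x \<le> 3 * q \<and> 1 \<le> y \<and> y \<le> 3 * q \<and>
    x < y + 2 * q \<and> y < x + 2 * q \<and> 2 * q < x + y"
  using assms by (auto simp: pentagon_def triangle_def)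

lemma finite_pentagon: "finite (pentagon q)"
  by (simp add: pentagon_def triangle_def)

text \<open>Column \<open>x\<close> of the triangle has \<open>2 x - 1\<close> points, and the first \<open>q\<close> odd numbers add up to
  \<open>q\<^sup>2\<close>; strict inequalities on the slanted sides are what makes this exact.\<close>

lemma card_triangle: "card (triangle q) = q\<^sup>2"
proof -
  have "card (triangle q) = (\<Sum>x=1..q. 2 * x - 1)"
    unfolding triangle_def by (subst card_SigmaI) (auto intro!: sum.cong)
  also have "\<dots> = q\<^sup>2"
    by (induction q) (simp_all add: power2_eq_square)
  finally show ?thesis .
qed

lemma card_pentagon: "card (pentagon q) = 6 * q\<^sup>2"
proof -
  let ?S = "{q<..3 * q} \<times> {q<..3 * q}"
  have fin: "finite (triangle q)"
    by (simp add: triangle_def)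
  have "card (pentagon q) = card ?S + card (triangle q) + card (prod.swap ` triangle q)"
    unfolding pentagon_def
    by (subst card_Un_disjoint, use fin in \<open>auto simp: triangle_def\<close>)+
  moreover have "card (prod.swap ` triangle q) = card (triangle q)"
    by (intro card_image inj_onI) auto
  ultimately show ?thesis
    by (simp add: card_triangle power2_eq_square)
qed

section \<open>The two armies\<close>

definition black_army :: "nat \<Rightarrow> nat \<Rightarrow> (nat \<times> nat) set" where
  "black_army h q =
     pentagon q \<union> (\<lambda>(x, y). (2 * h + 1 - x, 2 * h + 1 - y)) ` pentagon q"

text \<open>Reversing the second axis interchanges the roles of sum and difference. Since the pentagon is
  symmetric under swapping the coordinates, the reversed copy is also a quarter turn of it. The
  two pieces are exchanged by the point reflection in \<open>(h + 1/2, h + 1/2)\<close>.\<close>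

definition white_army :: "nat \<Rightarrow> nat \<Rightarrow> (nat \<times> nat) set" where
  "white_army h q =
     (\<lambda>(x, y). (h + x, h + 1 - y)) ` pentagon q \<union>
     (\<lambda>(x, y). (h + 1 - x, h + y)) ` pentagon q"

lemma black_armyD:
  assumes "(i, j) \<in> black_army h q" and "6 * q \<le> h"
  shows "i \<in> {1..3 * q} \<union> {2 * h + 1 - 3 * q..2 * h}"
    and "j \<in> {1..3 * q} \<union> {2 * h + 1 - 3 * q..2 * h}"
    and "\<bar>int i - int j\<bar> < 2 * int q"
    and "\<bar>int i + int j - (2 * int h + 1)\<bar> \<ge> 2 * int h + 1 - 6 * int q"
    and "\<bar>int i + int j - (2 * int h + 1)\<bar> < 2 * int h + 1 - 2 * int q"
  using assms by (auto simp: black_army_def of_nat_diff dest!: pentagonD)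

lemma white_armyD:
  assumes "(i, j) \<in> white_army h q" and "6 * q \<le> h"
  shows "i \<in> {3 * q<..<2 * h + 1 - 3 * q}"
    and "j \<in> {3 * q<..<2 * h + 1 - 3 * q}"
    and "\<bar>int i - int j\<bar> \<ge> 2 * int q"
    and "\<bar>int i - int j\<bar> < 6 * int q"
    and "\<bar>int i + int j - (2 * int h + 1)\<bar> < 2 * int q"
  using assms by (auto simp: white_army_def of_nat_diff dest!: pentagonD)

lemma card_black_army:
  assumes "6 * q \<le> h"
  shows "card (black_army h q) = 12 * q\<^sup>2"
proof -
  let ?f = "\<lambda>(x, y). (2 * h + 1 - x, 2 * h + 1 - y)"
  have "inj_on ?f (pentagon q)"
    using assms by (auto intro!: inj_onI dest!: pentagonD)
  moreover have "pentagon q \<inter> ?f ` pentagon q = {}"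
    using assms by (auto dest!: pentagonD)
  ultimately show ?thesis
    by (simp add: black_army_def card_Un_disjoint card_image finite_pentagon card_pentagon)
qed

lemma card_white_army:
  assumes "6 * q \<le> h"
  shows "card (white_army h q) = 12 * q\<^sup>2"
proof -
  let ?f = "\<lambda>(x, y). (h + x, h + 1 - y)" and ?g = "\<lambda>(x, y). (h + 1 - x, h + y)"
  have "inj_on ?f (pentagon q)" "inj_on ?g (pentagon q)"
    using assms by (auto intro!: inj_onI dest!: pentagonD)
  moreover have "?f ` pentagon q \<inter> ?g ` pentagon q = {}"
    using assms by (auto dest!: pentagonD)
  ultimately show ?thesis
    by (simp add: white_army_def card_Un_disjoint card_image finite_pentagon card_pentagon)
qed

section \<open>The battle is peaceful\<close>

lemma peaceful_battleI:
  assumes "B \<subseteq> torus_vertices n" "W \<subseteq> torus_vertices n"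
    and "\<And>i j k l. \<lbrakk>(i, j) \<in> B; (k, l) \<in> W\<rbrakk> \<Longrightarrow> i \<noteq> k \<and> j \<noteq> l \<and>
      \<not> [int i - int j = int k - int l] (mod int n) \<and>
      \<not> [int i + int j = int k + int l] (mod int n)"
  shows "peaceful_battle n B W"
proof -
  have "e \<inter> B = {} \<or> e \<inter> W = {}" if e: "e \<in> torus_hyperedges n" for e
  proof (rule ccontr)
    assume "\<not> ?thesis"
    then obtain i j k l where
      b: "(i, j) \<in> e" "(i, j) \<in> B" and w: "(k, l) \<in> e" "(k, l) \<in> W"
      by auto
    from e b(1) w(1) have "i = k \<or> j = l \<or>
      [int i - int j = int k - int l] (mod int n) \<or>
      [int i + int j = int k + int l] (mod int n)"
      by (auto simp: torus_hyperedges_def torus_row_def torus_column_def torus_diagonal_def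
        torus_skew_diagonal_def intro: cong_trans cong_sym)
    with assms(3)[OF b(2) w(2)] show False
      by blast
  qed
  moreover have "B \<inter> W = {}"
    using assms(3) by fastforce
  ultimately show ?thesis
    using assms(1,2) by (simp add: peaceful_battle_def)
qed

lemma not_cong_if_close:
  fixes a b m :: int
  assumes "a \<noteq> b" "\<bar>a - b\<bar> < m"
  shows "\<not> [a = b] (mod m)"
proof
  assume "[a = b] (mod m)"
  then have "m dvd a - b"
    by (simp add: cong_iff_dvd_diff)
  with assms show False
    using dvd_imp_le_int[of "a - b" m] by auto
qed

text \<open>Both armies keep their coordinate differences, and their sums relative to \<open>n\<close>, so small that
  a black and a white value are never \<open>n\<close> or more apart. Congruence would therefore force
  equality, which the thresholds \<open>2 q\<close> and \<open>n - 6 q \<ge> 2 q\<close> exclude.\<close>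

lemma peaceful_battle_armies:
  assumes "6 * q \<le> h"
  shows "peaceful_battle (2 * h + 1) (black_army h q) (white_army h q)"
proof (rule peaceful_battleI)
  show "black_army h q \<subseteq> torus_vertices (2 * h + 1)"
    using black_armyD(1,2)[OF _ assms] assms by (fastforce simp: torus_vertices_def)
  show "white_army h q \<subseteq> torus_vertices (2 * h + 1)"
    using white_armyD(1,2)[OF _ assms] by (fastforce simp: torus_vertices_def)
next
  fix i j k l
  assume "(i, j) \<in> black_army h q" "(k, l) \<in> white_army h q"
  note b = black_armyD[OF this(1) assms] and w = white_armyD[OF this(2) assms]
  have "i \<noteq> k" "j \<noteq> l"
    using b(1,2) w(1,2) by auto
  moreover have "\<not> [int i - int j = int k - int l] (mod int (2 * h + 1))"
    by (rule not_cong_if_close) (use b(3) w(3,4) assms in linarith)+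
  moreover have "\<not> [int i + int j = int k + int l] (mod int (2 * h + 1))"
    by (rule not_cong_if_close) (use b(4,5) w(5) assms in linarith)+
  ultimately show "i \<noteq> k \<and> j \<noteq> l \<and>
      \<not> [int i - int j = int k - int l] (mod int (2 * h + 1)) \<and>
      \<not> [int i + int j = int k + int l] (mod int (2 * h + 1))"
    by blast
qed

section \<open>The lower bound\<close>

lemma peaceful_number_ge:
  assumes "odd n"
  shows "12 * (n div 12)\<^sup>2 \<le> peaceful_number n"
proof -
  from assms obtain h where n: "n = 2 * h + 1"
    by (rule oddE)
  define q where "q = n div 12"
  have "6 * q \<le> h"
    unfolding q_def n by linarith
  then have "12 * q\<^sup>2 \<in> peaceful_sizes n"
    using peaceful_battle_armies card_black_army card_white_army
    unfolding peaceful_sizes_def n by blast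
  then show ?thesis
    unfolding peaceful_number_def q_def by (intro Max_ge finite_peaceful_sizes)
qed

theorem theorem1p3:
  shows "\<exists>N::nat. \<forall>n\<ge>N. odd n \<longrightarrow> real (peaceful_number n) \<ge> 0.0833 * (real n)^2"
proof (intro exI allI impI)
  fix n :: nat
  assume n: "60000 \<le> n" and "odd n"
  have "real n \<le> 12 * real (n div 12) + 11"
    by linarith
  \<comment> \<open>The factor \<open>0.9998\<close> satisfies \<open>0.9998\<^sup>2 / 12 > 0.0833\<close>, and \<open>0.0002 n\<close> exceeds \<open>11\<close>.\<close>
  then have "0.9998 * real n \<le> 12 * real (n div 12)"
    using of_nat_mono[OF n, where 'a = real] by simp
  then have "(0.9998 * real n)\<^sup>2 \<le> (12 * real (n div 12))\<^sup>2"
    by (intro power_mono) auto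
  then have "0.0833 * (real n)\<^sup>2 \<le> 12 * (real (n div 12))\<^sup>2"
    unfolding power_mult_distrib
    by (simp add: power2_eq_square) (use zero_le_square[of "real n"] in linarith)
  also have "\<dots> = real (12 * (n div 12)\<^sup>2)"
    by simp
  also have "\<dots> \<le> real (peaceful_number n)"
    using peaceful_number_ge[OF \<open>odd n\<close>] by (intro of_nat_mono)
  finally show "0.0833 * (real n)\<^sup>2 \<le> real (peaceful_number n)" .
qed

end
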